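(* Let $X$ and $Y$ be Hausdorff spaces and let $\tau:X\to X$ be a fixed-point free involution. The triple $\left((X,\tau);Y\right)$ does not satisfy the Borsuk-Ulam property (BUP) if and only if there exists a $\mathbb{Z}_2$-equivariant continuous map $\varphi:X\to F(Y,2)$ such that $$q^Y\circ\varphi=\overline{\varphi}\circ q,$$ where $q:X\to X/\tau$ and $q^Y:F(Y,2)\to D(Y,2)$ are the 2-sheeted covering (quotient) maps and $\overline{\varphi}:X/\tau\to D(Y,2)$ is the map induced by $\varphi$ on the quotient spaces.
   Context: The triple $\left((X,\tau);Y\right)$ satisfies the Borsuk-Ulam property (BUP) if for every continuous map $f:X\to Y$ there exists $x\in X$ with $f(\tau(x))=f(x)$. $F(Y,2)=\{(y_1,y_2)\in Y\times Y: y_1\neq y_2\}$ with the subspace topology, with the free involution $\tau_2(y_1,y_2)=(y_2,y_1)$, and $D(Y,2)=F(Y,2)/\tau_2$. $\mathbb{Z}_2$ acts on $X$ by $\tau$ and on $F(Y,2)$ by $\tau_2$. *)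

theory Defs
  imports "HOL-Analysis.Analysis"
begin

text \<open>Spaces are values of type \<^typ>\<open>'a topology\<close> (the empty space included); maps are HOL
  functions of which only the values on the carrier \<^const>\<open>topspace\<close> matter.\<close>

definition free_involution :: "'a topology \<Rightarrow> ('a \<Rightarrow> 'a) \<Rightarrow> bool" where
  "free_involution X \<tau> \<longleftrightarrow>
     continuous_map X X \<tau> \<and> (\<forall>x\<in>topspace X. \<tau> (\<tau> x) = x) \<and> (\<forall>x\<in>topspace X. \<tau> x \<noteq> x)"

definition borsuk_ulam_property :: "'a topology \<Rightarrow> ('a \<Rightarrow> 'a) \<Rightarrow> 'b topology \<Rightarrow> bool" where
  "borsuk_ulam_property X \<tau> Y \<longleftrightarrow>
     (\<forall>f. continuous_map X Y f \<longrightarrow> (\<exists>x\<in>topspace X. f (\<tau> x) = f x))"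

text \<open>Points of the quotient by an involution are the orbits \<open>{x, \<tau> x}\<close>; \<open>orbit_proj \<tau>\<close> is the
  canonical projection and \<open>orbit_space X \<tau>\<close> carries the quotient topology.\<close>

definition orbit_proj :: "('a \<Rightarrow> 'a) \<Rightarrow> 'a \<Rightarrow> 'a set" where
  "orbit_proj \<tau> x = {x, \<tau> x}"

definition orbit_space :: "'a topology \<Rightarrow> ('a \<Rightarrow> 'a) \<Rightarrow> 'a set topology" where
  "orbit_space X \<tau> =
     topology (\<lambda>U. U \<subseteq> orbit_proj \<tau> ` topspace X \<and> openin X {x \<in> topspace X. orbit_proj \<tau> x \<in> U})"

text \<open>\<open>F(Y,2)\<close>; its involution \<open>\<tau>\<^sub>2\<close> is \<^const>\<open>prod.swap\<close>.\<close>

definition conf_space :: "'b topology \<Rightarrow> ('b \<times> 'b) topology" where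
  "conf_space Y = subtopology (prod_topology Y Y) {(y1, y2). y1 \<noteq> y2}"

text \<open>\<open>D(Y,2)\<close>\<close>

definition unordered_conf_space :: "'b topology \<Rightarrow> ('b \<times> 'b) set topology" where
  "unordered_conf_space Y = orbit_space (conf_space Y) prod.swap"

definition equivariant :: "'a topology \<Rightarrow> ('a \<Rightarrow> 'a) \<Rightarrow> ('b \<Rightarrow> 'b) \<Rightarrow> ('a \<Rightarrow> 'b) \<Rightarrow> bool" where
  "equivariant X \<tau> \<sigma> \<phi> \<longleftrightarrow> (\<forall>x\<in>topspace X. \<phi> (\<tau> x) = \<sigma> (\<phi> x))"

text \<open>The class of \<open>x\<close> goes to the class of \<open>\<phi> x\<close>; for equivariant \<open>\<phi>\<close> this does not depend on the
  representative chosen.\<close>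

definition induced_map :: "('b \<Rightarrow> 'b) \<Rightarrow> ('a \<Rightarrow> 'b) \<Rightarrow> 'a set \<Rightarrow> 'b set" where
  "induced_map \<sigma> \<phi> c = orbit_proj \<sigma> (\<phi> (SOME x. x \<in> c))"

definition two_sheeted_covering :: "'a topology \<Rightarrow> 'b topology \<Rightarrow> ('a \<Rightarrow> 'b) \<Rightarrow> bool" where
  "two_sheeted_covering E B p \<longleftrightarrow>
     continuous_map E B p \<and> p ` topspace E = topspace B \<and>
     (\<forall>b\<in>topspace B. \<exists>W. openin B W \<and> b \<in> W \<and>
        (\<exists>U V. openin E U \<and> openin E V \<and> disjnt U V \<and> U \<union> V = {x \<in> topspace E. p x \<in> W} \<and>
               homeomorphic_map (subtopology E U) (subtopology B W) p \<and>
               homeomorphic_map (subtopology E V) (subtopology B W) p))"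

lemma openin_orbit_space:
  "openin (orbit_space X \<tau>) U \<longleftrightarrow>
     U \<subseteq> orbit_proj \<tau> ` topspace X \<and> openin X {x \<in> topspace X. orbit_proj \<tau> x \<in> U}"
proof -
  have "istopology (\<lambda>U. U \<subseteq> orbit_proj \<tau> ` topspace X \<and> openin X {x \<in> topspace X. orbit_proj \<tau> x \<in> U})"
    (is "istopology ?P")
    unfolding istopology_def
  proof (rule conjI; intro allI impI)
    fix S T assume "?P S" "?P T"
    moreover have "{x \<in> topspace X. orbit_proj \<tau> x \<in> S \<inter> T} =
        {x \<in> topspace X. orbit_proj \<tau> x \<in> S} \<inter> {x \<in> topspace X. orbit_proj \<tau> x \<in> T}"
      by auto
    ultimately show "?P (S \<inter> T)" by (metis (no_types, lifting) le_infI1 openin_Int)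
  next
    fix K assume K: "\<forall>S\<in>K. ?P S"
    have "{x \<in> topspace X. orbit_proj \<tau> x \<in> \<Union>K} = (\<Union>S\<in>K. {x \<in> topspace X. orbit_proj \<tau> x \<in> S})"
      by auto
    moreover have "openin X (\<Union>S\<in>K. {x \<in> topspace X. orbit_proj \<tau> x \<in> S})"
      using K by blast
    ultimately show "?P (\<Union>K)" using K by (simp only: ) blast
  qed
  then show ?thesis unfolding orbit_space_def by simp
qed

lemma topspace_orbit_space: "topspace (orbit_space X \<tau>) = orbit_proj \<tau> ` topspace X"
proof
  show "topspace (orbit_space X \<tau>) \<subseteq> orbit_proj \<tau> ` topspace X"
    using openin_orbit_space openin_topspace by blast
  have "{x \<in> topspace X. orbit_proj \<tau> x \<in> orbit_proj \<tau> ` topspace X} = topspace X" by auto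
  then have "openin (orbit_space X \<tau>) (orbit_proj \<tau> ` topspace X)"
    unfolding openin_orbit_space by simp
  then show "orbit_proj \<tau> ` topspace X \<subseteq> topspace (orbit_space X \<tau>)"
    by (rule openin_subset)
qed

lemma quotient_map_orbit_proj: "quotient_map X (orbit_space X \<tau>) (orbit_proj \<tau>)"
  unfolding quotient_map_def topspace_orbit_space openin_orbit_space by blast

lemma free_involution_swap: "free_involution (conf_space Y) prod.swap"
proof -
  have "continuous_map (prod_topology Y Y) (prod_topology Y Y) prod.swap"
    unfolding prod.swap_def by (intro continuous_map_pairedI continuous_map_fst continuous_map_snd)
  then show ?thesis
    unfolding free_involution_def conf_space_def
    by (auto simp: continuous_map_in_subtopology continuous_map_from_subtopology)
qed

lemma Hausdorff_space_conf_space: "Hausdorff_space Y \<Longrightarrow> Hausdorff_space (conf_space Y)"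
  unfolding conf_space_def by (simp add: Hausdorff_space_subtopology Hausdorff_space_prod_topology)

lemma orbit_proj_eq_iff:
  assumes "free_involution X \<tau>" "x \<in> topspace X" "y \<in> topspace X"
  shows "orbit_proj \<tau> x = orbit_proj \<tau> y \<longleftrightarrow> x = y \<or> x = \<tau> y"
  using assms unfolding free_involution_def orbit_proj_def by (metis doubleton_eq_iff)

lemma two_sheeted_covering_orbit_proj:
  assumes H: "Hausdorff_space X" and fi: "free_involution X \<tau>"
  shows "two_sheeted_covering X (orbit_space X \<tau>) (orbit_proj \<tau>)"
proof -
  let ?q = "orbit_proj \<tau>" and ?B = "orbit_space X \<tau>"
  have cont: "continuous_map X X \<tau>" and inv: "\<And>x. x \<in> topspace X \<Longrightarrow> \<tau> (\<tau> x) = x"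
    and free: "\<And>x. x \<in> topspace X \<Longrightarrow> \<tau> x \<noteq> x"
    using fi by (auto simp: free_involution_def)
  have mem: "\<tau> x \<in> topspace X" if "x \<in> topspace X" for x
    using cont that by (auto simp: continuous_map_def)
  note qeq = orbit_proj_eq_iff[OF fi]
  have qc: "continuous_map X ?B ?q"
    by (rule quotient_imp_continuous_map[OF quotient_map_orbit_proj])
  have sw: "?q (\<tau> x) = ?q x" if "x \<in> topspace X" for x
    using inv[OF that] by (auto simp: orbit_proj_def)
  have pre: "{x \<in> topspace X. ?q x \<in> ?q ` U} = U \<union> {x \<in> topspace X. \<tau> x \<in> U}"
    if "U \<subseteq> topspace X" for U
  proof (intro equalityI subsetI)
    fix x assume "x \<in> {x \<in> topspace X. ?q x \<in> ?q ` U}"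
    then obtain u where x: "x \<in> topspace X" and u: "u \<in> U" "?q x = ?q u" by blast
    then have "x = u \<or> x = \<tau> u" using qeq that by blast
    then show "x \<in> U \<union> {x \<in> topspace X. \<tau> x \<in> U}"
      using u x inv that by auto
  next
    fix x assume x: "x \<in> U \<union> {x \<in> topspace X. \<tau> x \<in> U}"
    then have xX: "x \<in> topspace X" using that by blast
    have "?q x \<in> ?q ` U"
    proof (cases "x \<in> U")
      case False
      then have "\<tau> x \<in> U" using x by blast
      then show ?thesis using sw[OF xX] by (metis imageI)
    qed simp
    then show "x \<in> {x \<in> topspace X. ?q x \<in> ?q ` U}" using xX by blast
  qed
  have qo: "open_map X ?B ?q"
    unfolding open_map_def
  proof (intro allI impI)
    fix U assume U: "openin X U"
    then have "openin X {x \<in> topspace X. \<tau> x \<in> U}"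
      using cont by (simp add: openin_continuous_map_preimage)
    then show "openin ?B (?q ` U)"
      unfolding openin_orbit_space pre[OF openin_subset[OF U]]
      using U openin_subset by (blast intro: openin_Un)
  qed
  have homeo: "homeomorphic_map (subtopology X U) (subtopology ?B W) ?q"
    if U: "openin X U" and W: "W = ?q ` U" and inj: "inj_on ?q U" for U W
  proof (rule bijective_open_imp_homeomorphic_map)
    have UX: "U \<subseteq> topspace X" using U openin_subset by blast
    have oW: "openin ?B W" using qo U W by (simp add: open_map_def)
    have tW: "topspace (subtopology ?B W) = W" using oW openin_subset by (metis topspace_subtopology_subset)
    have tU: "topspace (subtopology X U) = U" using UX by (metis topspace_subtopology_subset)
    show "continuous_map (subtopology X U) (subtopology ?B W) ?q"
      using qc W tU by (auto simp: continuous_map_in_subtopology continuous_map_from_subtopology)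
    show "open_map (subtopology X U) (subtopology ?B W) ?q"
      unfolding open_map_def
    proof (intro allI impI)
      fix S assume "openin (subtopology X U) S"
      then have "openin X S" "S \<subseteq> U" using U openin_open_subtopology by blast+
      then show "openin (subtopology ?B W) (?q ` S)"
        using qo oW W unfolding open_map_def by (simp add: openin_open_subtopology image_mono)
    qed
    show "?q ` topspace (subtopology X U) = topspace (subtopology ?B W)"
      using tU tW W by simp
    show "inj_on ?q (topspace (subtopology X U))" using tU inj by simp
  qed
  show ?thesis
    unfolding two_sheeted_covering_def
  proof (intro conjI ballI)
    show "continuous_map X ?B ?q" by (rule qc)
    show "?q ` topspace X = topspace ?B" by (simp add: topspace_orbit_space)
    fix b assume "b \<in> topspace ?B"
    then obtain x where x: "x \<in> topspace X" and b: "b = ?q x"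
      by (auto simp: topspace_orbit_space)
    obtain A C where AC: "openin X A" "openin X C" "x \<in> A" "\<tau> x \<in> C" "disjnt A C"
      using H x mem[OF x] free[OF x] unfolding Hausdorff_space_def by metis
    define U where "U = A \<inter> {y \<in> topspace X. \<tau> y \<in> C}"
    define V where "V = {y \<in> topspace X. \<tau> y \<in> U}"
    have oU: "openin X U" unfolding U_def
      using AC cont by (simp add: openin_Int openin_continuous_map_preimage)
    have oV: "openin X V" unfolding V_def
      using oU cont by (simp add: openin_continuous_map_preimage)
    have UX: "U \<subseteq> topspace X" and VX: "V \<subseteq> topspace X"
      using oU oV openin_subset by blast+
    have VC: "V \<subseteq> C" using inv by (force simp: V_def U_def)
    then have dis: "disjnt U V" using AC(5) by (auto simp: U_def disjnt_def)
    have \<tau>U: "\<tau> y \<in> V" if "y \<in> U" for y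
      using that UX mem inv unfolding V_def by auto
    have \<tau>V: "\<tau> y \<in> U" if "y \<in> V" for y using that unfolding V_def by simp
    have qV: "?q ` U = ?q ` V"
    proof (intro equalityI subsetI)
      fix c assume "c \<in> ?q ` U"
      then obtain y where y: "y \<in> U" and c: "c = ?q y" by blast
      have "c = ?q (\<tau> y)" using sw y UX c by (metis subsetD)
      then show "c \<in> ?q ` V" using \<tau>U[OF y] by (rule image_eqI)
    next
      fix c assume "c \<in> ?q ` V"
      then obtain y where y: "y \<in> V" and c: "c = ?q y" by blast
      have "c = ?q (\<tau> y)" using sw y VX c by (metis subsetD)
      then show "c \<in> ?q ` U" using \<tau>V[OF y] by (rule image_eqI)
    qed
    have injU: "inj_on ?q U"
    proof (rule inj_onI)
      fix y z assume yz: "y \<in> U" "z \<in> U" "?q y = ?q z"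
      then have "y = z \<or> y = \<tau> z" using qeq UX by blast
      then show "y = z" using \<tau>U[OF yz(2)] yz(1) dis by (auto simp: disjnt_def)
    qed
    have injV: "inj_on ?q V"
    proof (rule inj_onI)
      fix y z assume yz: "y \<in> V" "z \<in> V" "?q y = ?q z"
      then have "y = z \<or> y = \<tau> z" using qeq VX by blast
      then show "y = z" using \<tau>V[OF yz(2)] yz(1) dis by (auto simp: disjnt_def)
    qed
    have xU: "x \<in> U" using AC x by (simp add: U_def)
    show "\<exists>W. openin ?B W \<and> b \<in> W \<and>
        (\<exists>U V. openin X U \<and> openin X V \<and> disjnt U V \<and> U \<union> V = {x \<in> topspace X. ?q x \<in> W} \<and>
               homeomorphic_map (subtopology X U) (subtopology ?B W) ?q \<and>
               homeomorphic_map (subtopology X V) (subtopology ?B W) ?q)"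
    proof (rule exI[of _ "?q ` U"], intro conjI)
      show "openin ?B (?q ` U)" using qo oU by (simp add: open_map_def)
      show "b \<in> ?q ` U" using b xU by simp
      show "\<exists>U' V. openin X U' \<and> openin X V \<and> disjnt U' V \<and>
          U' \<union> V = {x \<in> topspace X. ?q x \<in> ?q ` U} \<and>
          homeomorphic_map (subtopology X U') (subtopology ?B (?q ` U)) ?q \<and>
          homeomorphic_map (subtopology X V) (subtopology ?B (?q ` U)) ?q"
        using oU oV dis pre[OF UX, folded V_def, symmetric] homeo[OF oU refl injU] homeo[OF oV qV injV]
        by (intro exI[of _ U] exI[of _ V] conjI)
    qed
  qed
qed

end

theory Submission
  imports Defs
begin

text \<open>A map \<open>f\<close> violating the Borsuk-Ulam property is the same thing as an equivariant map into
  \<open>F(Y,2)\<close>. Indeed \<open>f (\<tau> x) \<noteq> f x\<close> for all \<open>x\<close> says that \<open>x \<mapsto> (f x, f (\<tau> x))\<close> avoids the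
  diagonal, and this map is equivariant because replacing \<open>x\<close> by \<open>\<tau> x\<close> exchanges the two
  coordinates. Conversely, equivariance forces the second coordinate of \<open>\<phi> x\<close> to be the first
  coordinate of \<open>\<phi> (\<tau> x)\<close>, so the first coordinate of \<open>\<phi>\<close> separates \<open>x\<close> from \<open>\<tau> x\<close>.

  The conditions on the induced map hold for every continuous equivariant map: the square
  commutes since orbits go to orbits (\<open>induced_map_orbit_proj\<close>), and continuity descends because
  the projection onto the orbit space is a quotient map (\<open>continuous_map_induced_map\<close>).\<close>

text \<open>The representative on which \<^const>\<open>induced_map\<close> evaluates \<open>\<phi>\<close> may be \<open>\<tau> x\<close> rather than \<open>x\<close>;
  equivariance then gives \<open>\<sigma> (\<phi> x)\<close>, whose \<open>\<sigma>\<close>-orbit is that of \<open>\<phi> x\<close> once \<open>\<sigma>\<close> undoes itself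
  there.\<close>

lemma induced_map_orbit_proj:
  assumes "equivariant X \<tau> \<sigma> \<phi>" and "x \<in> topspace X" and "\<sigma> (\<sigma> (\<phi> x)) = \<phi> x"
  shows "induced_map \<sigma> \<phi> (orbit_proj \<tau> x) = orbit_proj \<sigma> (\<phi> x)"
proof -
  define y where "y = (SOME y. y \<in> orbit_proj \<tau> x)"
  have "y \<in> orbit_proj \<tau> x"
    unfolding y_def by (rule someI[of _ x]) (simp add: orbit_proj_def)
  then consider "y = x" | "y = \<tau> x"
    by (auto simp: orbit_proj_def)
  then have "orbit_proj \<sigma> (\<phi> y) = orbit_proj \<sigma> (\<phi> x)"
  proof cases
    case 2
    then have "\<phi> y = \<sigma> (\<phi> x)"
      using assms(1,2) by (simp add: equivariant_def)
    then show ?thesis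
      using assms(3) by (simp add: orbit_proj_def insert_commute)
  qed simp
  then show ?thesis
    by (simp add: induced_map_def y_def)
qed

text \<open>By the universal property of the quotient map onto the orbit space, it suffices that
  \<open>induced_map \<sigma> \<phi> \<circ> orbit_proj \<tau>\<close> is continuous, and this composite is \<open>orbit_proj \<sigma> \<circ> \<phi>\<close>.\<close>

lemma continuous_map_induced_map:
  assumes "continuous_map X Z \<phi>" and "equivariant X \<tau> \<sigma> \<phi>"
    and "\<And>z. z \<in> topspace Z \<Longrightarrow> \<sigma> (\<sigma> z) = z"
  shows "continuous_map (orbit_space X \<tau>) (orbit_space Z \<sigma>) (induced_map \<sigma> \<phi>)"
proof (rule continuous_compose_quotient_map[OF quotient_map_orbit_proj])
  have "continuous_map X (orbit_space Z \<sigma>) (orbit_proj \<sigma> \<circ> \<phi>)"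
    using assms(1) quotient_imp_continuous_map[OF quotient_map_orbit_proj]
    by (rule continuous_map_compose)
  moreover have "(orbit_proj \<sigma> \<circ> \<phi>) x = (induced_map \<sigma> \<phi> \<circ> orbit_proj \<tau>) x"
    if "x \<in> topspace X" for x
  proof -
    have "\<phi> x \<in> topspace Z"
      using assms(1) that by (auto simp: continuous_map_def)
    then show ?thesis
      using induced_map_orbit_proj[OF assms(2) that] assms(3) by simp
  qed
  ultimately show "continuous_map X (orbit_space Z \<sigma>) (induced_map \<sigma> \<phi> \<circ> orbit_proj \<tau>)"
    by (rule continuous_map_eq)
qed

theorem proposition2p3:
  fixes X :: "'a topology" and Y :: "'b topology" and \<tau> :: "'a \<Rightarrow> 'a"
  assumes "Hausdorff_space X" and "Hausdorff_space Y"
    and "free_involution X \<tau>"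
  shows "\<not> borsuk_ulam_property X \<tau> Y \<longleftrightarrow>
    (\<exists>\<phi>. continuous_map X (conf_space Y) \<phi> \<and> equivariant X \<tau> prod.swap \<phi> \<and>
      continuous_map (orbit_space X \<tau>) (unordered_conf_space Y) (induced_map prod.swap \<phi>) \<and>
      (\<forall>x\<in>topspace X.
         (orbit_proj prod.swap \<circ> \<phi>) x = (induced_map prod.swap \<phi> \<circ> orbit_proj \<tau>) x))"
    (is "_ \<longleftrightarrow> (\<exists>\<phi>. ?P \<phi>)")
proof
  assume "\<not> borsuk_ulam_property X \<tau> Y"
  then obtain f where f: "continuous_map X Y f" and ne: "\<And>x. x \<in> topspace X \<Longrightarrow> f (\<tau> x) \<noteq> f x"
    by (auto simp: borsuk_ulam_property_def)
  define \<phi> where "\<phi> = (\<lambda>x. (f x, f (\<tau> x)))"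
  have "continuous_map X Y (\<lambda>x. f (\<tau> x))"
    using assms(3) f continuous_map_compose[of X X \<tau> Y f]
    by (simp add: free_involution_def comp_def)
  then have "continuous_map X (prod_topology Y Y) \<phi>"
    unfolding \<phi>_def using f by (intro continuous_map_pairedI)
  moreover have "\<phi> x \<in> {(y1, y2). y1 \<noteq> y2}" if "x \<in> topspace X" for x
    using ne[OF that] by (auto simp: \<phi>_def)
  ultimately have cont: "continuous_map X (conf_space Y) \<phi>"
    by (auto simp: conf_space_def continuous_map_in_subtopology)
  have equi: "equivariant X \<tau> prod.swap \<phi>"
    using assms(3) by (simp add: equivariant_def free_involution_def \<phi>_def)
  have "continuous_map (orbit_space X \<tau>) (unordered_conf_space Y) (induced_map prod.swap \<phi>)"
    unfolding unordered_conf_space_def by (rule continuous_map_induced_map[OF cont equi]) simp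
  then have "?P \<phi>"
    using cont equi by (simp add: induced_map_orbit_proj[OF equi])
  then show "\<exists>\<phi>. ?P \<phi>"
    by blast
next
  assume "\<exists>\<phi>. ?P \<phi>"
  then obtain \<phi> where cont: "continuous_map X (conf_space Y) \<phi>"
    and equi: "equivariant X \<tau> prod.swap \<phi>"
    by blast
  have "continuous_map X (prod_topology Y Y) \<phi>"
    and ne: "\<And>x. x \<in> topspace X \<Longrightarrow> fst (\<phi> x) \<noteq> snd (\<phi> x)"
    using cont by (auto simp: conf_space_def continuous_map_in_subtopology image_subset_iff
        split_beta Pi_iff)
  then have "continuous_map X Y (fst \<circ> \<phi>)"
    using continuous_map_compose continuous_map_fst by blast
  moreover have "(fst \<circ> \<phi>) (\<tau> x) \<noteq> (fst \<circ> \<phi>) x" if "x \<in> topspace X" for x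
    using equi ne[OF that] that by (simp add: equivariant_def)
  ultimately show "\<not> borsuk_ulam_property X \<tau> Y"
    unfolding borsuk_ulam_property_def by blast
qed

end
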